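(* Let $q$ be an odd prime power. Then $$|C_{2,q}|=1+(q-1)(1+\chi(-1))=\begin{cases}2q-1,&\chi(-1)=1,\\ 1,&\chi(-1)=-1,\end{cases}$$ whereas $|B_{2,q}|=q$. Thus in odd characteristic the equality $|B_{n,q}|=|C_{n,q}|$ does not hold in general.
   Context: For a finite field $\mathbb F_q$, $B_{n,q}$ is the set of $n\times n$ upper triangular matrices $X$ over $\mathbb F_q$ with $X^2=0$, and $C_{n,q}$ is the set of $n\times n$ upper triangular matrices $U$ over $\mathbb F_q$ with $U^TU=0$. $\chi$ is the quadratic character of $\mathbb F_q$ ($1$ on nonzero squares, $-1$ on nonsquares, $0$ at $0$). *)

theory Defs
  imports
    "Jordan_Normal_Form.Matrix"
    "HOL-Computational_Algebra.Nth_Powers"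
    "HOL-Number_Theory.Prime_Powers"
begin

text \<open>The finite field is a type of classes \<open>field\<close> and \<open>finite\<close>, with q its cardinality;
  the matrix size n stays an ordinary natural number.\<close>

definition Bset :: "nat \<Rightarrow> 'a::field mat set" where
  "Bset n = {X \<in> carrier_mat n n. upper_triangular X \<and> X ^\<^sub>m 2 = 0\<^sub>m n n}"

definition Cset :: "nat \<Rightarrow> 'a::field mat set" where
  "Cset n = {U \<in> carrier_mat n n. upper_triangular U \<and> transpose_mat U * U = 0\<^sub>m n n}"

definition quad_char :: "'a::field \<Rightarrow> int" where
  "quad_char a = (if a = 0 then 0 else if is_square a then 1 else - 1)"

end

theory Submission
  imports Defs
begin

text \<open>
  An upper triangular matrix of order 2 is determined by its entries \<open>a\<close>, \<open>b\<close> (first row) and \<open>d\<close>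
  (second diagonal entry), and over a field the two matrix equations say something simple about
  these entries.  The square has entries \<open>a\<^sup>2\<close>, \<open>a b + b d\<close> and \<open>d\<^sup>2\<close>, so it vanishes exactly when
  \<open>a = d = 0\<close>, which leaves the \<open>q\<close> choices of \<open>b\<close>.  The Gram matrix has entries \<open>a\<^sup>2\<close>, \<open>a b\<close> and
  \<open>b\<^sup>2 + d\<^sup>2\<close>, so it vanishes exactly when \<open>a = 0\<close> and \<open>(b, d)\<close> is a zero of the quadratic form
  \<open>b\<^sup>2 + d\<^sup>2\<close>.

  That form is governed by whether \<open>-1\<close> is a square.  If it is not, the form is anisotropic
  and only the zero vector remains.  If \<open>-1 = i\<^sup>2\<close>, the form factors as \<open>(b - i d) (b + i d)\<close>, and
  its zeros are two lines through the origin.  They are distinct because \<open>2\<close> is nonzero in a field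
  of odd order; hence there are \<open>2 q - 1\<close> zeros.  Both counts differ from \<open>q > 1\<close>.
\<close>

definition upper_tri2 :: "'a::zero \<Rightarrow> 'a \<Rightarrow> 'a \<Rightarrow> 'a mat" where
  "upper_tri2 a b d = mat_of_rows_list 2 [[a, b], [0, d]]"

lemma upper_tri2_carrier [simp]: "upper_tri2 a b d \<in> carrier_mat 2 2"
  by (simp add: upper_tri2_def mat_of_rows_list_def numeral_2_eq_2)

lemma upper_tri2_index:
  "upper_tri2 a b d $$ (0, 0) = a" "upper_tri2 a b d $$ (0, Suc 0) = b"
  "upper_tri2 a b d $$ (Suc 0, 0) = 0" "upper_tri2 a b d $$ (Suc 0, Suc 0) = d"
  by (simp_all add: upper_tri2_def mat_of_rows_list_def)

lemma mat2_eq_iff: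
  assumes "A \<in> carrier_mat 2 2" "B \<in> carrier_mat 2 2"
  shows "A = B \<longleftrightarrow> A $$ (0, 0) = B $$ (0, 0) \<and> A $$ (0, Suc 0) = B $$ (0, Suc 0)
    \<and> A $$ (Suc 0, 0) = B $$ (Suc 0, 0) \<and> A $$ (Suc 0, Suc 0) = B $$ (Suc 0, Suc 0)"
  using assms by (auto intro!: eq_matI simp: less_2_cases_iff)

lemma upper_tri2_inject:
  "upper_tri2 a b d = upper_tri2 a' b' d' \<longleftrightarrow> a = a' \<and> b = b' \<and> d = d'"
  by (auto simp: mat2_eq_iff upper_tri2_index)

lemma upper_triangular_carrier2_iff:
  "A \<in> carrier_mat 2 2 \<and> upper_triangular A \<longleftrightarrow> (\<exists>a b d. A = upper_tri2 a b d)"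
proof
  assume A: "A \<in> carrier_mat 2 2 \<and> upper_triangular A"
  then have "A $$ (Suc 0, 0) = 0"
    by (auto simp: upper_triangular_def)
  with A have "A = upper_tri2 (A $$ (0, 0)) (A $$ (0, Suc 0)) (A $$ (Suc 0, Suc 0))"
    by (simp add: mat2_eq_iff upper_tri2_index)
  then show "\<exists>a b d. A = upper_tri2 a b d"
    by blast
next
  assume "\<exists>a b d. A = upper_tri2 a b d"
  then obtain a b d where A: "A = upper_tri2 a b d"
    by blast
  have "dim_row A = 2"
    unfolding A by (rule carrier_matD(1)[OF upper_tri2_carrier])
  then show "A \<in> carrier_mat 2 2 \<and> upper_triangular A"
    using A by (auto simp: upper_triangular_def less_2_cases_iff upper_tri2_index)
qed

lemma square_upper_tri2_eq_0_iff:
  fixes a b d :: "'a::field"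
  shows "upper_tri2 a b d ^\<^sub>m 2 = 0\<^sub>m 2 2 \<longleftrightarrow> a = 0 \<and> d = 0"
proof -
  let ?U = "upper_tri2 a b d"
  have dims: "dim_row ?U = 2" "dim_col ?U = 2"
    by (rule carrier_matD[OF upper_tri2_carrier])+
  have "?U ^\<^sub>m 2 = ?U * ?U"
    using dims by (simp add: numeral_2_eq_2)
  also have "\<dots> = 0\<^sub>m 2 2 \<longleftrightarrow> a = 0 \<and> d = 0"
    using dims
    by (subst mat2_eq_iff) (auto simp: scalar_prod_def upper_tri2_index numeral_2_eq_2)
  finally show ?thesis .
qed

lemma gram_upper_tri2_eq_0_iff:
  fixes a b d :: "'a::field"
  shows "transpose_mat (upper_tri2 a b d) * upper_tri2 a b d = 0\<^sub>m 2 2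
    \<longleftrightarrow> a = 0 \<and> b\<^sup>2 + d\<^sup>2 = 0"
proof -
  let ?U = "upper_tri2 a b d"
  have dims: "dim_row ?U = 2" "dim_col ?U = 2"
    by (rule carrier_matD[OF upper_tri2_carrier])+
  show ?thesis
    using dims
    by (subst mat2_eq_iff)
      (auto simp: scalar_prod_def upper_tri2_index numeral_2_eq_2)
qed

lemma Bset_2: "Bset 2 = range (\<lambda>b::'a::field. upper_tri2 0 b 0)"
proof -
  have "X \<in> Bset 2 \<longleftrightarrow> (\<exists>a b d. X = upper_tri2 a b d) \<and> X ^\<^sub>m 2 = 0\<^sub>m 2 2" for X :: "'a mat"
    using upper_triangular_carrier2_iff[of X] unfolding Bset_def by blast
  then show ?thesis
    by (auto simp: square_upper_tri2_eq_0_iff upper_tri2_inject)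
qed

lemma Cset_2:
  "Cset 2 = (\<lambda>(b, d). upper_tri2 0 b d) ` {(b, d :: 'a::field). b\<^sup>2 + d\<^sup>2 = 0}"
proof -
  have "U \<in> Cset 2 \<longleftrightarrow> (\<exists>a b d. U = upper_tri2 a b d) \<and> transpose_mat U * U = 0\<^sub>m 2 2"
    for U :: "'a mat"
    using upper_triangular_carrier2_iff[of U] unfolding Cset_def by blast
  then show ?thesis
    by (auto simp: gram_upper_tri2_eq_0_iff upper_tri2_inject image_iff)
qed

lemma card_Bset_2: "card (Bset 2 :: 'a::field mat set) = card (UNIV :: 'a set)"
  unfolding Bset_2 by (rule card_image) (simp add: inj_on_def upper_tri2_inject)

lemma card_Cset_2:
  "card (Cset 2 :: 'a::field mat set) = card {(b, d :: 'a). b\<^sup>2 + d\<^sup>2 = 0}"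
  unfolding Cset_2 by (rule card_image) (auto simp: inj_on_def upper_tri2_inject)

text \<open>Translation by \<open>1\<close> permutes the field, so the sum of all elements equals itself plus
  \<open>of_nat q\<close>; hence \<open>q = 0\<close> in the field.  If \<open>2 = 0\<close> as well, an odd \<open>q\<close> would give \<open>1 = 0\<close>.\<close>

lemma two_neq_0_if_odd_card:
  assumes "odd (card (UNIV :: 'a::{field,finite} set))"
  shows "(2 :: 'a) \<noteq> 0"
proof
  assume two: "(2 :: 'a) = 0"
  have "(\<Sum>x\<in>UNIV. x :: 'a) = (\<Sum>x\<in>UNIV. x + 1)"
    by (rule sum.reindex_bij_witness[of _ "\<lambda>x. x + 1" "\<lambda>x. x - 1"]) auto
  also have "\<dots> = (\<Sum>x\<in>UNIV. x) + of_nat (card (UNIV :: 'a set))"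
    by (simp add: sum.distrib)
  finally have "of_nat (card (UNIV :: 'a set)) = (0 :: 'a)"
    by simp
  with assms two show False
    by (auto elim!: oddE)
qed

text \<open>A nonzero isotropic vector \<open>(b, d)\<close> has \<open>d \<noteq> 0\<close>, and then \<open>b / d\<close> is a square root
  of \<open>-1\<close>.\<close>

lemma isotropic_if_nonsquare:
  assumes "\<not> is_square (- 1 :: 'a::field)"
  shows "{(b, d :: 'a). b\<^sup>2 + d\<^sup>2 = 0} = {(0, 0)}"
proof -
  have "b = 0 \<and> d = 0" if eq: "b\<^sup>2 + d\<^sup>2 = 0" for b d :: 'a
  proof (cases "d = 0")
    case False
    have "b\<^sup>2 = - d\<^sup>2"
      using eq by (simp add: eq_neg_iff_add_eq_0)
    then have "(b / d)\<^sup>2 = - 1"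
      using False by (simp add: power_divide)
    then have "is_square (- 1 :: 'a)"
      by (metis is_nth_powerI)
    with assms show ?thesis
      by contradiction
  qed (use eq in simp)
  then have "b\<^sup>2 + d\<^sup>2 = 0 \<longleftrightarrow> b = 0 \<and> d = 0" for b d :: 'a
    by (metis add_0 zero_power2)
  then show ?thesis
    by auto
qed

text \<open>The isotropic vectors form the lines \<open>b = i d\<close> and \<open>b = - i d\<close>, which meet only in the
  origin since \<open>2 i \<noteq> 0\<close>.\<close>

lemma card_isotropic_if_square:
  fixes i :: "'a::{field,finite}"
  assumes i: "i\<^sup>2 = - 1" and two: "(2 :: 'a) \<noteq> 0"
  shows "card {(b, d :: 'a). b\<^sup>2 + d\<^sup>2 = 0} = 2 * card (UNIV :: 'a set) - 1"
proof -
  define L where "L c = range (\<lambda>d :: 'a. (c * d, d))" for c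
  have card_L: "card (L c) = card (UNIV :: 'a set)" for c
    unfolding L_def by (rule card_image) (simp add: inj_on_def)
  have mem_L: "(b, d) \<in> L c \<longleftrightarrow> b = c * d" for b c d
    by (auto simp: L_def)
  have "b\<^sup>2 + d\<^sup>2 = (b - i * d) * (b + i * d)" for b d
  proof -
    have "(b - i * d) * (b + i * d) = b\<^sup>2 - i\<^sup>2 * d\<^sup>2"
      by (simp add: power2_eq_square algebra_simps)
    with i show ?thesis
      by simp
  qed
  then have "{(b, d). b\<^sup>2 + d\<^sup>2 = 0} = L i \<union> L (- i)"
    by (auto simp: mem_L eq_neg_iff_add_eq_0)
  moreover have "L i \<inter> L (- i) = {(0, 0)}"
  proof -
    have "i \<noteq> 0"
      using i by auto
    have meet: "d = 0" if "i * d = - i * d" for d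
    proof -
      have "2 * (i * d) = 0"
        using that by (metis add.right_inverse mult_2 mult_minus_left)
      with two \<open>i \<noteq> 0\<close> show ?thesis
        by simp
    qed
    have "p \<in> L i \<inter> L (- i) \<longleftrightarrow> p = (0, 0)" for p
      using meet[of "snd p"] by (cases p) (auto simp: mem_L)
    then show ?thesis
      by blast
  qed
  ultimately show ?thesis
    using card_Un_Int[of "L i" "L (- i)"] card_L by simp
qed

theorem corollary6p8:
  fixes q :: nat
  assumes "primepow q" and "odd q" and "card (UNIV :: 'a::{field,finite} set) = q"
  shows "int (card (Cset 2 :: 'a mat set)) = 1 + (int q - 1) * (1 + quad_char (- 1 :: 'a))
    \<and> (quad_char (- 1 :: 'a) = 1 \<or> quad_char (- 1 :: 'a) = - 1)
    \<and> (quad_char (- 1 :: 'a) = 1 \<longrightarrow> int (card (Cset 2 :: 'a mat set)) = 2 * int q - 1)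
    \<and> (quad_char (- 1 :: 'a) = - 1 \<longrightarrow> card (Cset 2 :: 'a mat set) = 1)
    \<and> card (Bset 2 :: 'a mat set) = q
    \<and> \<not> (\<forall>n. card (Bset n :: 'a mat set) = card (Cset n :: 'a mat set))"
proof -
  have q: "q > 1"
    using \<open>primepow q\<close> by (rule primepow_gt_Suc_0[unfolded One_nat_def[symmetric]])
  have B: "card (Bset 2 :: 'a mat set) = q"
    using assms(3) by (simp add: card_Bset_2)
  show ?thesis
  proof (cases "is_square (- 1 :: 'a)")
    case True
    then obtain i :: 'a where "i\<^sup>2 = - 1"
      by (metis is_nth_powerE)
    then have "card (Cset 2 :: 'a mat set) = 2 * q - 1"
      using card_isotropic_if_square two_neq_0_if_odd_card assms by (metis card_Cset_2)
    moreover from this q B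
    have "\<not> (\<forall>n. card (Bset n :: 'a mat set) = card (Cset n :: 'a mat set))"
      by (intro notI) (drule spec[of _ 2], simp)
    moreover have "quad_char (- 1 :: 'a) = 1"
      using True by (simp add: quad_char_def)
    ultimately show ?thesis
      using B q by (simp add: of_nat_diff)
  next
    case False
    then have "card (Cset 2 :: 'a mat set) = 1"
      by (simp add: card_Cset_2 isotropic_if_nonsquare)
    moreover from this q B
    have "\<not> (\<forall>n. card (Bset n :: 'a mat set) = card (Cset n :: 'a mat set))"
      by (intro notI) (drule spec[of _ 2], simp)
    moreover have "quad_char (- 1 :: 'a) = - 1"
      using False by (simp add: quad_char_def)
    ultimately show ?thesis
      using B by simp
  qed
qed

end
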